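(* Let $G$ be a countable infinite discrete group, $X$ a compact metrizable abelian group with normalized Haar measure $\nu$, and $\sigma: G\curvearrowright (X,\nu)$ an algebraic action. Suppose $\sigma$ is weakly mixing as a p.m.p. action. Then the natural map $\Psi_1: H^1(G,\mathbb{T})\to H^1(G\curvearrowright X;\mathbb{T})$ is injective, and the map $$\Phi_1: H^1(G,\widehat{X})\to \frac{H^1(G\curvearrowright X;\mathbb{T})}{\Psi_1(H^1(G,\mathbb{T}))},\qquad \Phi_1([c])=[\tilde c]+\Psi_1(H^1(G,\mathbb{T})),$$ where $\tilde c(g,x)=c(g)(x)$, is a well-defined injective group homomorphism.
   Context: An algebraic action of $G$ is a homomorphism $G\to \mathrm{Aut}(X)$ into the group of continuous automorphisms of a compact metrizable abelian group $X$; it preserves Haar measure. $\widehat X$ is the Pontryagin dual (continuous homomorphisms $X\to\mathbb{T}$, $\mathbb{T}$ the unit circle), a left $\mathbb{Z}G$-module via $(g\chi)(x)=\chi(g^{-1}x)$. A p.m.p. action is weakly mixing if the diagonal action on $(X\times X,\nu\times\nu)$ is ergodic. Group cohomology $H^n(G,M)$ for a left $G$-module $M$ is defined via inhomogeneous cochains $G^n\to M$ with the standard coboundary $(\delta c)(g_1,\dots,g_{n+1})=g_1c(g_2,\dots,g_{n+1})+\sum_{i=1}^n(-1)^ic(g_1,\dots,g_ig_{i+1},\dots,g_{n+1})+(-1)^{n+1}c(g_1,\dots,g_n)$; $\mathbb{T}$ carries the trivial $G$-action, so $H^1(G,\mathbb{T})=\mathrm{Hom}(G,\mathbb{T})$.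 For a p.m.p. action $G\curvearrowright(X,\mu)$, a measurable map $c:G^n\times X\to\mathbb{T}$ is an $n$-cocycle if for all $g_1,\dots,g_{n+1}\in G$ and $\mu$-a.e. $x$: $c(g_2,\dots,g_{n+1},g_1^{-1}x)\prod_{i=1}^n c(g_1,\dots,g_ig_{i+1},\dots,g_{n+1},x)^{(-1)^i}\cdot c(g_1,\dots,g_n,x)^{(-1)^{n+1}}=1$. Two $n$-cocycles $c_1,c_2$ are cohomologous if there is a measurable $b:G^{n-1}\times X\to\mathbb{T}$ with, for all $g_i$ and a.e. $x$, $c_1(g_1,\dots,g_n,x)\,b(g_2,\dots,g_n,g_1^{-1}x)\prod_{i=1}^{n-1}b(g_1,\dots,g_ig_{i+1},\dots,g_n,x)^{(-1)^i}\cdot b(g_1,\dots,g_{n-1},x)^{(-1)^n}=c_2(g_1,\dots,g_n,x)$. $H^n(G\curvearrowright X;\mathbb{T})$ is the abelian group (pointwise multiplication) of $n$-cocycles modulo those cohomologous to the constant $1$. The natural map $\Psi_n:H^n(G,\mathbb{T})\to H^n(G\curvearrowright X;\mathbb{T})$ sends $[c]$ to the class of $(g_1,\dots,g_n,x)\mapsto c(g_1,\dots,g_n)$. *)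

theory Defs
  imports "HOL-Probability.Probability"
begin

text \<open>Conventions. The discrete group G is a type of class group_add (written additively,
  not necessarily commutative: g + h is the product, - g the inverse, 0 the identity).
  X is a type of class topological_ab_group_add + metric_space (a metrizable abelian topological
  group), compactness is the assumption compact UNIV. The circle T is the set of complex numbers
  of modulus 1, with multiplication.\<close>

definition haar_measure :: "('x::{topological_ab_group_add,metric_space}) measure \<Rightarrow> bool" where
  "haar_measure \<nu> \<longleftrightarrow> prob_space \<nu> \<and> sets \<nu> = sets borel \<and>
     (\<forall>a. \<forall>A\<in>sets \<nu>. emeasure \<nu> ((\<lambda>x. a + x) -` A) = emeasure \<nu> A)"

text \<open>Algebraic action: homomorphism from G into continuous automorphisms of X
  (a left action by continuous group homomorphisms; bijectivity follows).\<close>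
definition algebraic_action ::
  "('g::group_add \<Rightarrow> 'x::{topological_ab_group_add,metric_space} \<Rightarrow> 'x) \<Rightarrow> bool" where
  "algebraic_action \<sigma> \<longleftrightarrow>
     (\<forall>x. \<sigma> 0 x = x) \<and> (\<forall>g h x. \<sigma> (g + h) x = \<sigma> g (\<sigma> h x)) \<and>
     (\<forall>g. continuous_on UNIV (\<sigma> g)) \<and> (\<forall>g x y. \<sigma> g (x + y) = \<sigma> g x + \<sigma> g y)"

definition ergodic_action :: "('g \<Rightarrow> 'a \<Rightarrow> 'a) \<Rightarrow> 'a measure \<Rightarrow> bool" where
  "ergodic_action T M \<longleftrightarrow>
     (\<forall>A\<in>sets M. (\<forall>g. T g -` A \<inter> space M = A) \<longrightarrow> measure M A = 0 \<or> measure M A = 1)"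

definition weakly_mixing :: "('g \<Rightarrow> 'a \<Rightarrow> 'a) \<Rightarrow> 'a measure \<Rightarrow> bool" where
  "weakly_mixing T M \<longleftrightarrow> ergodic_action (\<lambda>g (x, y). (T g x, T g y)) (M \<Otimes>\<^sub>M M)"

definition dual_char :: "('x::{topological_ab_group_add,metric_space} \<Rightarrow> complex) \<Rightarrow> bool" where
  "dual_char \<xi> \<longleftrightarrow> continuous_on UNIV \<xi> \<and> (\<forall>x. cmod (\<xi> x) = 1) \<and>
     (\<forall>x y. \<xi> (x + y) = \<xi> x * \<xi> y)"

definition dual_act :: "('g::group_add \<Rightarrow> 'x \<Rightarrow> 'x) \<Rightarrow> 'g \<Rightarrow> ('x \<Rightarrow> complex) \<Rightarrow> ('x \<Rightarrow> complex)" where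
  "dual_act \<sigma> g \<xi> = (\<lambda>x. \<xi> (\<sigma> (- g) x))"

definition dual_cocycle ::
  "('g::group_add \<Rightarrow> 'x::{topological_ab_group_add,metric_space} \<Rightarrow> 'x) \<Rightarrow> ('g \<Rightarrow> 'x \<Rightarrow> complex) \<Rightarrow> bool" where
  "dual_cocycle \<sigma> c \<longleftrightarrow> (\<forall>g. dual_char (c g)) \<and>
     (\<forall>g h. c (g + h) = (\<lambda>x. c g x * dual_act \<sigma> g (c h) x))"

definition dual_cohomologous ::
  "('g::group_add \<Rightarrow> 'x::{topological_ab_group_add,metric_space} \<Rightarrow> 'x) \<Rightarrow> ('g \<Rightarrow> 'x \<Rightarrow> complex) \<Rightarrow> ('g \<Rightarrow> 'x \<Rightarrow> complex) \<Rightarrow> bool" where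
  "dual_cohomologous \<sigma> c1 c2 \<longleftrightarrow>
     (\<exists>b. dual_char b \<and> (\<forall>g x. c1 g x * dual_act \<sigma> g b x * inverse (b x) = c2 g x))"

text \<open>Measurable 1-cocycles G \<times> X \<rightarrow> T for the action (G discrete countable, so joint
  measurability is measurability of every slice).\<close>
definition meas_cocycle ::
  "('g::group_add \<Rightarrow> 'x \<Rightarrow> 'x) \<Rightarrow> 'x measure \<Rightarrow> ('g \<Rightarrow> 'x \<Rightarrow> complex) \<Rightarrow> bool" where
  "meas_cocycle \<sigma> \<nu> c \<longleftrightarrow> (\<forall>g. c g \<in> borel_measurable \<nu>) \<and> (\<forall>g x. cmod (c g x) = 1) \<and>
     (\<forall>g1 g2. AE x in \<nu>. c g2 (\<sigma> (- g1) x) * inverse (c (g1 + g2) x) * c g1 x = 1)"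

definition meas_cohomologous ::
  "('g::group_add \<Rightarrow> 'x \<Rightarrow> 'x) \<Rightarrow> 'x measure \<Rightarrow> ('g \<Rightarrow> 'x \<Rightarrow> complex) \<Rightarrow> ('g \<Rightarrow> 'x \<Rightarrow> complex) \<Rightarrow> bool" where
  "meas_cohomologous \<sigma> \<nu> c1 c2 \<longleftrightarrow>
     (\<exists>b. b \<in> borel_measurable \<nu> \<and> (\<forall>x. cmod (b x) = 1) \<and>
       (\<forall>g. AE x in \<nu>. c1 g x * b (\<sigma> (- g) x) * inverse (b x) = c2 g x))"

text \<open>H^1(G,T) = Hom(G,T) (trivial action, no nontrivial coboundaries).\<close>
definition circle_hom :: "('g::group_add \<Rightarrow> complex) \<Rightarrow> bool" where
  "circle_hom \<phi> \<longleftrightarrow> (\<forall>g. cmod (\<phi> g) = 1) \<and> (\<forall>g h. \<phi> (g + h) = \<phi> g * \<phi> h)"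

definition Psi1 :: "('g \<Rightarrow> complex) \<Rightarrow> ('g \<Rightarrow> 'x \<Rightarrow> complex)" where
  "Psi1 \<phi> = (\<lambda>g x. \<phi> g)"

definition tilde :: "('g \<Rightarrow> 'x \<Rightarrow> complex) \<Rightarrow> ('g \<Rightarrow> 'x \<Rightarrow> complex)" where
  "tilde c = (\<lambda>g x. c g x)"

end

theory Submission
  imports Defs
begin

text \<open>A transfer function \<open>b\<close> between cocycles satisfies
  \<open>b (g\<^sup>-\<^sup>1 x) = \<kappa> g * \<xi> g x * b x\<close> almost everywhere, with constants \<open>\<kappa> g\<close> of modulus 1 and
  characters \<open>\<xi> g\<close>. Its autocorrelation \<open>\<rho> t = \<integral> b (x + t) * cnj (b x) dx\<close> is continuous, and
  the constants cancel: \<open>\<rho> (g\<^sup>-\<^sup>1 t) = \<xi> g t * \<rho> t\<close> for every \<open>t\<close>. Hence \<open>cmod \<circ> \<rho>\<close> is invariant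
  and continuous, so by ergodicity it is constantly \<open>cmod (\<rho> 0) = 1\<close>. The equality case of the triangle
  inequality then gives \<open>b (x + t) = \<rho> t * b x\<close>, so \<open>\<rho>\<close> is a character, and it is the required
  transfer function in the dual. If all \<open>\<xi> g\<close> are trivial, \<open>\<rho>\<close> itself is invariant, so \<open>\<rho> = 1\<close>
  and \<open>b\<close> is constant.\<close>

section \<open>Borel sets in a product of compact metric spaces\<close>

text \<open>The class instances of \<open>'x\<close> do not provide second countability, so \<open>borel_prod\<close> does not apply;
  compactness of the whole space supplies the countable base.\<close>
lemma open_in_sets_pair_borel:
  fixes W :: "('a::metric_space \<times> 'b::metric_space) set"
  assumes "compact (UNIV :: 'a set)" "compact (UNIV :: 'b set)" "open W"
  shows "W \<in> sets (borel \<Otimes>\<^sub>M borel)"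
proof -
  have "\<exists>K. finite K \<and> (UNIV :: 'a set) \<subseteq> (\<Union>k\<in>K. ball k (inverse (Suc n)))" for n
    using assms(1) unfolding compact_eq_totally_bounded by simp
  then obtain K where K: "\<And>n. finite (K n)" "\<And>n. (UNIV :: 'a set) \<subseteq> (\<Union>k\<in>K n. ball k (inverse (Suc n)))"
    by metis
  have "\<exists>L. finite L \<and> (UNIV :: 'b set) \<subseteq> (\<Union>k\<in>L. ball k (inverse (Suc n)))" for n
    using assms(2) unfolding compact_eq_totally_bounded by simp
  then obtain L where L: "\<And>n. finite (L n)" "\<And>n. (UNIV :: 'b set) \<subseteq> (\<Union>k\<in>L n. ball k (inverse (Suc n)))"
    by metis
  \<comment> \<open>Finite nets at all scales 1/(n+1) give countably many boxes. \<open>I\<close>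
    selects those inside \<open>W\<close>, and their union will be \<open>W\<close>.\<close>
  define R where "R = (\<lambda>(n, k :: 'a, l :: 'b). ball k (inverse (Suc n)) \<times> ball l (inverse (Suc n)))"
  define I where "I = {p \<in> (SIGMA n:UNIV. K n \<times> L n). R p \<subseteq> W}"
  have "\<exists>p\<in>I. z \<in> R p" if "z \<in> W" for z
  proof -
    obtain x y where z: "z = (x, y)" by (cases z)
    obtain A B where AB: "open A" "open B" "x \<in> A" "y \<in> B" "A \<times> B \<subseteq> W"
      using open_prod_elim[OF \<open>open W\<close> \<open>z \<in> W\<close>] z by (metis mem_Sigma_iff)
    obtain e where e: "e > 0" "ball x e \<subseteq> A" "ball y e \<subseteq> B"
    proof -
      obtain e1 e2 where "e1 > 0" "ball x e1 \<subseteq> A" "e2 > 0" "ball y e2 \<subseteq> B"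
        using AB by (meson openE)
      then show ?thesis
        using that[of "min e1 e2"] by (meson dual_order.trans min.cobounded1 min.cobounded2 min_less_iff_conj subset_ball)
    qed
    \<comment> \<open>A radius below \<open>e / 2\<close> suffices: a net point that close to
      \<open>x\<close> has its whole ball within distance \<open>e\<close> of
      \<open>x\<close>.\<close>
    obtain n where n: "inverse (real (Suc n)) < e / 2"
      using reals_Archimedean[of "e/2"] e by auto
    have "x \<in> (\<Union>k\<in>K n. ball k (inverse (Suc n)))" "y \<in> (\<Union>l\<in>L n. ball l (inverse (Suc n)))"
      using K(2) L(2) by blast+
    then obtain k l where kl: "k \<in> K n" "l \<in> L n" "dist k x < inverse (Suc n)" "dist l y < inverse (Suc n)"
      by auto
    have "ball k (inverse (Suc n)) \<subseteq> ball x e"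
    proof
      fix w assume "w \<in> ball k (inverse (Suc n))"
      then have "dist k w < e / 2" "dist k x < e / 2" using kl(3) n by simp_all
      then show "w \<in> ball x e" using dist_triangle_half_r by (metis mem_ball)
    qed
    moreover have "ball l (inverse (Suc n)) \<subseteq> ball y e"
    proof
      fix w assume "w \<in> ball l (inverse (Suc n))"
      then have "dist l w < e / 2" "dist l y < e / 2" using kl(4) n by simp_all
      then show "w \<in> ball y e" using dist_triangle_half_r by (metis mem_ball)
    qed
    ultimately have "R (n, k, l) \<subseteq> W"
      using e(2,3) AB(5) unfolding R_def prod.case by (meson Sigma_mono order_trans)
    moreover have "z \<in> R (n, k, l)" using kl z by (auto simp: R_def)
    ultimately show ?thesis using kl by (auto simp: I_def)
  qed
  then have "W = (\<Union>p\<in>I. R p)" unfolding I_def by blast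
  moreover have "countable I"
  proof (rule countable_subset)
    show "I \<subseteq> (SIGMA n:UNIV. K n \<times> L n)" by (simp add: I_def)
    show "countable (SIGMA n:UNIV. K n \<times> L n)"
      using K(1) L(1) by (intro countable_SIGMA) (auto intro: countable_finite)
  qed
  moreover have "R p \<in> sets (borel \<Otimes>\<^sub>M borel)" for p
    by (cases p rule: prod_cases3) (simp add: R_def pair_measureI)
  ultimately show ?thesis using sets.countable_UN'[of I R] by (metis image_subsetI)
qed

section \<open>Haar measure: translation invariance, uniqueness, positivity on open sets\<close>

lemma haar_sets: "haar_measure \<nu> \<Longrightarrow> sets \<nu> = sets borel"
  and haar_prob_space: "haar_measure \<nu> \<Longrightarrow> prob_space \<nu>"
  by (auto simp: haar_measure_def)

lemma haar_space: "haar_measure \<nu> \<Longrightarrow> space \<nu> = UNIV"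
  using sets_eq_imp_space_eq[OF haar_sets] by auto

lemma haar_measurable: "haar_measure \<nu> \<Longrightarrow> borel_measurable \<nu> = borel_measurable borel"
  by (intro measurable_cong_sets haar_sets) auto

lemma translate_measurable:
  fixes a :: "'x::{topological_ab_group_add,metric_space}"
  shows "(\<lambda>x. x + a) \<in> borel \<rightarrow>\<^sub>M borel"
  by (intro borel_measurable_continuous_onI continuous_intros)

lemma haar_distr:
  fixes \<nu> :: "('x::{topological_ab_group_add,metric_space}) measure"
  assumes "haar_measure \<nu>"
  shows "distr \<nu> borel (\<lambda>x. x + a) = \<nu>"
proof (rule measure_eqI)
  fix A assume "A \<in> sets (distr \<nu> borel (\<lambda>x. x + a))"
  then have A: "A \<in> sets borel" by simp
  have "(\<lambda>x. x + a) \<in> \<nu> \<rightarrow>\<^sub>M borel"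
    using translate_measurable haar_measurable[OF assms] by blast
  then have "emeasure (distr \<nu> borel (\<lambda>x. x + a)) A = emeasure \<nu> ((\<lambda>x. a + x) -` A)"
    using A by (simp add: emeasure_distr haar_space[OF assms] add.commute)
  also have "\<dots> = emeasure \<nu> A"
    using assms A by (auto simp: haar_measure_def)
  finally show "emeasure (distr \<nu> borel (\<lambda>x. x + a)) A = emeasure \<nu> A" .
qed (simp add: haar_sets[OF assms])

lemma haar_AE_translate:
  fixes \<nu> :: "('x::{topological_ab_group_add,metric_space}) measure"
  assumes h: "haar_measure \<nu>" and "AE x in \<nu>. P x"
  shows "AE x in \<nu>. P (x + a)"
proof -
  have "(\<lambda>x. x + a) \<in> \<nu> \<rightarrow>\<^sub>M borel"
    using translate_measurable haar_measurable[OF h] by blast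
  then show ?thesis
    using AE_distrD[of "\<lambda>x. x + a" \<nu> borel P] assms(2) unfolding haar_distr[OF h] by simp
qed

lemma haar_integral_translate:
  fixes \<nu> :: "('x::{topological_ab_group_add,metric_space}) measure"
    and f :: "'x \<Rightarrow> 'b::{banach,second_countable_topology}"
  assumes h: "haar_measure \<nu>" and f: "f \<in> borel_measurable borel"
  shows "(LINT x|\<nu>. f (x + a)) = (LINT x|\<nu>. f x)"
  using integral_distr[of "\<lambda>x. x + a" \<nu> borel f] f translate_measurable[of a]
  by (simp add: haar_distr[OF h] haar_measurable[OF h])

lemma haar_integrable_translate:
  fixes \<nu> :: "('x::{topological_ab_group_add,metric_space}) measure"
    and f :: "'x \<Rightarrow> 'b::{banach,second_countable_topology}"
  assumes h: "haar_measure \<nu>" and f: "integrable \<nu> f"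
  shows "integrable \<nu> (\<lambda>x. f (x + a))"
proof -
  have "f \<in> borel_measurable borel"
    using borel_measurable_integrable[OF f] unfolding haar_measurable[OF h] .
  moreover have "(\<lambda>x. x + a) \<in> \<nu> \<rightarrow>\<^sub>M borel"
    using translate_measurable haar_measurable[OF h] by blast
  ultimately show ?thesis
    using integrable_distr_eq[of "\<lambda>x. x + a" \<nu> borel f] f unfolding haar_distr[OF h] by blast
qed

text \<open>Continuity of addition gives open preimages in the product space; compactness puts these
  into the product sigma-algebra. This makes Fubini available for functions of
  \<open>x + y\<close>.\<close>

lemma plus_measurable_pair:
  fixes \<mu> \<nu> :: "('x::{topological_ab_group_add,metric_space}) measure"
  assumes "compact (UNIV :: 'x set)" and m: "haar_measure \<mu>" and n: "haar_measure \<nu>"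
  shows "(\<lambda>p. fst p + snd p) \<in> (\<mu> \<Otimes>\<^sub>M \<nu>) \<rightarrow>\<^sub>M borel"
proof -
  have "sets (\<mu> \<Otimes>\<^sub>M \<nu>) = sets (borel \<Otimes>\<^sub>M borel)"
    using haar_sets m n by (metis sets_pair_measure_cong)
  moreover have "open {p :: 'x \<times> 'x. fst p + snd p \<in> S}" if "open S" for S
    using open_vimage[OF that continuous_on_add[OF continuous_on_fst continuous_on_snd], of id id]
    by (simp add: vimage_def continuous_on_id id_def)
  ultimately show ?thesis
    using open_in_sets_pair_borel[OF assms(1) assms(1)]
    by (intro borel_measurableI) (auto simp: vimage_def space_pair_measure haar_space m n)
qed

text \<open>Integrate the indicator of \<open>A\<close> at \<open>x + y\<close> over both variables.
  Whichever variable is integrated first, invariance makes the inner integral constant, equal to the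
  measure of \<open>A\<close> under that variable's measure; Fubini equates the two results.\<close>

lemma haar_unique:
  fixes \<mu> \<nu> :: "('x::{topological_ab_group_add,metric_space}) measure"
  assumes "compact (UNIV :: 'x set)" and m: "haar_measure \<mu>" and n: "haar_measure \<nu>"
  shows "\<mu> = \<nu>"
proof (rule measure_eqI)
  show "sets \<mu> = sets \<nu>" using haar_sets m n by metis
  fix A assume "A \<in> sets \<mu>"
  then have A: "A \<in> sets borel" by (simp add: haar_sets[OF m])
  interpret M: prob_space \<mu> by (rule haar_prob_space[OF m])
  interpret N: prob_space \<nu> by (rule haar_prob_space[OF n])
  interpret P: pair_sigma_finite \<mu> \<nu> ..
  have "(\<lambda>p. fst p + snd p) \<in> (\<mu> \<Otimes>\<^sub>M \<nu>) \<rightarrow>\<^sub>M (borel :: 'x measure)"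
    by (rule plus_measurable_pair[OF assms])
  then have meas: "(\<lambda>(x, y). indicator A (x + y) :: ennreal) \<in> borel_measurable (\<mu> \<Otimes>\<^sub>M \<nu>)"
    using A by (simp add: case_prod_beta)
  have inner: "(\<integral>\<^sup>+ x. indicator A (x + y) \<partial>\<kappa>) = emeasure \<kappa> A" if k: "haar_measure \<kappa>" for \<kappa> :: "'x measure" and y
    using nn_integral_distr[of "\<lambda>x. x + y" \<kappa> borel "indicator A"] A translate_measurable[of y]
    by (simp add: haar_distr[OF k] haar_measurable[OF k] haar_sets[OF k])
  have "emeasure \<mu> A = (\<integral>\<^sup>+ y. (\<integral>\<^sup>+ x. indicator A (x + y) \<partial>\<mu>) \<partial>\<nu>)"
    using N.emeasure_space_1 by (simp add: inner[OF m])
  also have "\<dots> = (\<integral>\<^sup>+ x. (\<integral>\<^sup>+ y. indicator A (y + x) \<partial>\<nu>) \<partial>\<mu>)"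
    using P.Fubini'[OF meas] by (simp add: add.commute)
  also have "\<dots> = emeasure \<nu> A"
    using M.emeasure_space_1 by (simp add: inner[OF n])
  finally show "emeasure \<mu> A = emeasure \<nu> A" .
qed

text \<open>Translates of \<open>U\<close> cover the compact group, so finitely many do. If
  \<open>U\<close> were null, so would be the whole space.\<close>

lemma haar_open_pos:
  fixes \<nu> :: "('x::{topological_ab_group_add,metric_space}) measure"
  assumes c: "compact (UNIV :: 'x set)" and h: "haar_measure \<nu>" and U: "open U" "U \<noteq> {}"
  shows "measure \<nu> U > 0"
proof (rule ccontr)
  interpret prob_space \<nu> by (rule haar_prob_space[OF h])
  assume "\<not> measure \<nu> U > 0"
  then have "emeasure \<nu> U = 0"
    by (simp add: emeasure_eq_measure zero_less_measure_iff)
  then have z: "emeasure \<nu> ((\<lambda>x. a + x) -` U) = 0" for a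
    using h U by (auto simp: haar_measure_def)
  have op: "open ((\<lambda>x. a + x) -` U)" for a
    by (intro open_vimage U continuous_intros)
  obtain u where u: "u \<in> U" using U by auto
  have "UNIV \<subseteq> (\<Union>a\<in>UNIV. (\<lambda>x. a + x) -` U)"
  proof
    fix x :: 'x
    \<comment> \<open>The shift \<open>u - x\<close> carries \<open>x\<close> to the chosen point
      \<open>u\<close> of \<open>U\<close>.\<close>
    have "(u - x) + x \<in> U" using u by simp
    then show "x \<in> (\<Union>a\<in>UNIV. (\<lambda>x. a + x) -` U)" by blast
  qed
  then obtain C where C: "finite C" "UNIV \<subseteq> (\<Union>a\<in>C. (\<lambda>x. a + x) -` U)"
    using compactE_image[OF c, of UNIV "\<lambda>a. (\<lambda>x. a + x) -` U"] op by auto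
  have "(\<Union>a\<in>C. (\<lambda>x. a + x) -` U) \<in> null_sets \<nu>"
    using C(1) z op by (intro null_sets.finite_UN) (auto simp: null_sets_def haar_sets[OF h])
  then have "space \<nu> \<in> null_sets \<nu>"
    using C(2) by (simp add: top.extremum_unique haar_space[OF h])
  then show False using emeasure_space_1 by (simp add: null_sets_def)
qed

section \<open>Invariance of Haar measure under the action, and consequences of ergodicity\<close>

lemma action_measurable:
  fixes \<sigma> :: "'g::group_add \<Rightarrow> 'x::{topological_ab_group_add,metric_space} \<Rightarrow> 'x"
  assumes h: "haar_measure \<nu>" and act: "algebraic_action \<sigma>"
  shows "\<sigma> g \<in> \<nu> \<rightarrow>\<^sub>M borel"
proof -
  have "\<sigma> g \<in> borel_measurable borel"
    using act by (auto simp: algebraic_action_def intro: borel_measurable_continuous_onI)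
  then show ?thesis
    using haar_measurable[OF h] by blast
qed

text \<open>The image of Haar measure under a group automorphism is again translation invariant, so
  uniqueness shows that the action preserves \<open>\<nu>\<close>.\<close>

lemma haar_action_distr:
  fixes \<sigma> :: "'g::group_add \<Rightarrow> 'x::{topological_ab_group_add,metric_space} \<Rightarrow> 'x"
  assumes c: "compact (UNIV :: 'x set)" and h: "haar_measure \<nu>" and act: "algebraic_action \<sigma>"
  shows "distr \<nu> borel (\<sigma> g) = \<nu>"
proof (rule haar_unique[OF c _ h])
  interpret prob_space \<nu> by (rule haar_prob_space[OF h])
  have m: "\<sigma> g \<in> \<nu> \<rightarrow>\<^sub>M borel" by (rule action_measurable[OF h act])
  have "emeasure (distr \<nu> borel (\<sigma> g)) ((\<lambda>x. a + x) -` A) = emeasure (distr \<nu> borel (\<sigma> g)) A"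
    if A: "A \<in> sets borel" for a A
  proof -
    have tr: "(\<lambda>x. a + x) -` A \<in> sets borel"
      using measurable_sets[OF translate_measurable[of a] A] by (simp add: add.commute)
    \<comment> \<open>Translating by \<open>a\<close> after \<open>\<sigma> g\<close> amounts to
      translating by \<open>\<sigma> (- g) a\<close> before it, so invariance of
      \<open>\<nu>\<close> passes to the image measure.\<close>
    have "\<sigma> g (\<sigma> (- g) a) = a"
      using act by (metis algebraic_action_def add.right_inverse)
    then have "a + \<sigma> g x = \<sigma> g (\<sigma> (- g) a + x)" for x
      using act by (metis algebraic_action_def)
    then have "\<sigma> g -` ((\<lambda>x. a + x) -` A) = (\<lambda>x. \<sigma> (- g) a + x) -` (\<sigma> g -` A)"
      by (simp add: vimage_def)
    moreover have "\<sigma> g -` A \<in> sets \<nu>"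
      using measurable_sets[OF m A] by (simp add: haar_space[OF h])
    ultimately show ?thesis
      using h A tr m by (simp add: emeasure_distr haar_space[OF h] haar_measure_def)
  qed
  then show "haar_measure (distr \<nu> borel (\<sigma> g))"
    using prob_space_distr[OF m] by (simp add: haar_measure_def)
qed

lemma haar_AE_action:
  fixes \<sigma> :: "'g::group_add \<Rightarrow> 'x::{topological_ab_group_add,metric_space} \<Rightarrow> 'x"
  assumes c: "compact (UNIV :: 'x set)" and h: "haar_measure \<nu>" and act: "algebraic_action \<sigma>"
    and "AE x in \<nu>. P x"
  shows "AE x in \<nu>. P (\<sigma> g x)"
  using AE_distrD[OF action_measurable[OF h act], of P g] assms(4)
  unfolding haar_action_distr[OF c h act] by simp

lemma haar_integral_action:
  fixes \<sigma> :: "'g::group_add \<Rightarrow> 'x::{topological_ab_group_add,metric_space} \<Rightarrow> 'x"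
    and f :: "'x \<Rightarrow> 'b::{banach,second_countable_topology}"
  assumes c: "compact (UNIV :: 'x set)" and h: "haar_measure \<nu>" and act: "algebraic_action \<sigma>"
    and f: "f \<in> borel_measurable borel"
  shows "(LINT x|\<nu>. f (\<sigma> g x)) = (LINT x|\<nu>. f x)"
  using integral_distr[OF action_measurable[OF h act] f, of g]
  unfolding haar_action_distr[OF c h act] by simp

text \<open>Weak mixing implies ergodicity: an invariant set \<open>A\<close> yields the set
  \<open>A \<times> space M\<close>, invariant under the diagonal action and of the same
  measure.\<close>

lemma weakly_mixing_invariant_set:
  assumes M: "prob_space M" and wm: "weakly_mixing T M" and A: "A \<in> sets M"
    and sp: "space M = UNIV" and inv: "\<And>g. T g -` A = A"
  shows "measure M A = 0 \<or> measure M A = 1"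
proof -
  interpret prob_space M by (rule M)
  have AU: "A \<times> space M \<in> sets (M \<Otimes>\<^sub>M M)" using A by auto
  have "(\<lambda>(x, y). (T g x, T g y)) -` (A \<times> space M) \<inter> space (M \<Otimes>\<^sub>M M) = A \<times> space M" for g
    using inv[of g] by (auto simp: sp space_pair_measure)
  then have "measure (M \<Otimes>\<^sub>M M) (A \<times> space M) = 0 \<or> measure (M \<Otimes>\<^sub>M M) (A \<times> space M) = 1"
    using wm AU unfolding weakly_mixing_def ergodic_action_def by blast
  moreover have "emeasure (M \<Otimes>\<^sub>M M) (A \<times> space M) = emeasure M A"
    using A by (simp add: emeasure_pair_measure_Times emeasure_space_1)
  ultimately show ?thesis by (simp add: measure_def)
qed

text \<open>Two distinct values have disjoint balls around them. Their preimages are open, nonempty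
  and invariant, so ergodicity gives each measure 1, which is too much for a probability measure.
  Positivity on open sets is what yields equality at every point instead of almost
  everywhere.\<close>

lemma invariant_continuous_const:
  fixes \<sigma> :: "'g::group_add \<Rightarrow> 'x::{topological_ab_group_add,metric_space} \<Rightarrow> 'x"
    and f :: "'x \<Rightarrow> 'b::metric_space"
  assumes c: "compact (UNIV :: 'x set)" and h: "haar_measure \<nu>" and wm: "weakly_mixing \<sigma> \<nu>"
    and f: "continuous_on UNIV f" and inv: "\<And>g x. f (\<sigma> g x) = f x"
  shows "f x = f y"
proof (rule ccontr)
  interpret prob_space \<nu> by (rule haar_prob_space[OF h])
  assume "f x \<noteq> f y"
  define r where "r = dist (f x) (f y) / 2"
  have r: "r > 0" using \<open>f x \<noteq> f y\<close> by (simp add: r_def)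
  have op: "open (f -` ball z r)" for z
    by (intro open_vimage f open_ball)
  then have ms: "f -` ball z r \<in> sets \<nu>" for z by (simp add: haar_sets[OF h])
  have pos: "measure \<nu> (f -` ball (f z) r) > 0" for z
  proof (rule haar_open_pos[OF c h op])
    have "z \<in> f -` ball (f z) r" using r by simp
    then show "f -` ball (f z) r \<noteq> {}" by blast
  qed
  have one: "measure \<nu> (f -` ball (f z) r) = 1" for z
    using weakly_mixing_invariant_set[OF prob_space_axioms wm ms haar_space[OF h], of "f z"] pos[of z]
    by (auto simp: vimage_def inv)
  have "(f -` ball (f x) r) \<inter> (f -` ball (f y) r) = {}"
    using dist_triangle_half_l[of "f x" _ "dist (f x) (f y)" "f y"] by (fastforce simp: r_def)
  then have "measure \<nu> (f -` ball (f x) r \<union> f -` ball (f y) r) = 1 + 1"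
    using ms by (simp add: finite_measure_Union one)
  then show False using prob_le_1[of "f -` ball (f x) r \<union> f -` ball (f y) r"] by simp
qed

section \<open>Continuity of translation in the L1 norm\<close>

text \<open>The L1 distance between \<open>f\<close> and its translate by \<open>a\<close>, that is,
  an integral modulus of continuity.\<close>

definition translation_defect ::
  "('x::{topological_ab_group_add,metric_space}) measure \<Rightarrow>
    ('x \<Rightarrow> 'b::{banach,second_countable_topology}) \<Rightarrow> 'x \<Rightarrow> real" where
  "translation_defect \<nu> f a = (LINT x|\<nu>. norm (f (x + a) - f x))"

lemma translation_defect_nonneg: "translation_defect \<nu> f a \<ge> 0"
  by (simp add: translation_defect_def)

lemma translation_defect_add:
  fixes f g :: "'x::{topological_ab_group_add,metric_space} \<Rightarrow> 'b::{banach,second_countable_topology}"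
  assumes h: "haar_measure \<nu>" and f: "integrable \<nu> f" and g: "integrable \<nu> g"
  shows "translation_defect \<nu> (\<lambda>x. f x + g x) a \<le> translation_defect \<nu> f a + translation_defect \<nu> g a"
proof -
  note int = haar_integrable_translate[OF h f, of a] haar_integrable_translate[OF h g, of a] f g
  have "translation_defect \<nu> (\<lambda>x. f x + g x) a \<le>
      (LINT x|\<nu>. norm (f (x + a) - f x) + norm (g (x + a) - g x))"
    unfolding translation_defect_def
  proof (rule integral_mono)
    show "norm (f (x + a) + g (x + a) - (f x + g x)) \<le> norm (f (x + a) - f x) + norm (g (x + a) - g x)" for x
      by (metis add_diff_add norm_triangle_ineq)
  qed (use int in auto)
  also have "\<dots> = translation_defect \<nu> f a + translation_defect \<nu> g a"
    unfolding translation_defect_def using int by (intro Bochner_Integration.integral_add) auto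
  finally show ?thesis .
qed

lemma translation_defect_le:
  fixes f :: "'x::{topological_ab_group_add,metric_space} \<Rightarrow> 'b::{banach,second_countable_topology}"
  assumes h: "haar_measure \<nu>" and f: "integrable \<nu> f"
  shows "translation_defect \<nu> f a \<le> 2 * (LINT x|\<nu>. norm (f x))"
proof -
  note int = haar_integrable_translate[OF h f, of a] f
  have "(\<lambda>x. norm (f x)) \<in> borel_measurable borel"
    using borel_measurable_integrable[OF integrable_norm[OF f]] unfolding haar_measurable[OF h] .
  then have "(LINT x|\<nu>. norm (f (x + a))) = (LINT x|\<nu>. norm (f x))"
    by (rule haar_integral_translate[OF h])
  moreover have "translation_defect \<nu> f a \<le> (LINT x|\<nu>. norm (f (x + a)) + norm (f x))"
    unfolding translation_defect_def using int by (intro integral_mono norm_triangle_ineq4) auto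
  moreover have "\<dots> = (LINT x|\<nu>. norm (f (x + a))) + (LINT x|\<nu>. norm (f x))"
    using int by (intro Bochner_Integration.integral_add) auto
  ultimately show ?thesis by simp
qed

text \<open>Continuity of translation passes to L1 limits: the defect of the error
  \<open>f - s i\<close> is at most twice its L1 norm, uniformly in the translation.\<close>

lemma translation_defect_lim:
  fixes f :: "'x::{topological_ab_group_add,metric_space} \<Rightarrow> 'b::{banach,second_countable_topology}"
  assumes h: "haar_measure \<nu>" and f: "integrable \<nu> f" and s: "\<And>i. integrable \<nu> (s i)"
    and lim: "(\<lambda>i::nat. LINT x|\<nu>. norm (f x - s i x)) \<longlonglongrightarrow> 0"
    and Q: "\<And>i. (\<lambda>n::nat. translation_defect \<nu> (s i) (t n)) \<longlonglongrightarrow> 0"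
  shows "(\<lambda>n. translation_defect \<nu> f (t n)) \<longlonglongrightarrow> 0"
proof (rule LIMSEQ_I)
  fix r :: real assume "0 < r"
  \<comment> \<open>The bound \<open>r / 4\<close> is doubled by
    \<open>translation_defect_le\<close>; the other \<open>r / 2\<close> is left for the defect of
    \<open>s i\<close>.\<close>
  then obtain i where "\<bar>LINT x|\<nu>. norm (f x - s i x)\<bar> < r / 4"
    using LIMSEQ_D[OF lim, of "r/4"] by auto
  then have i: "(LINT x|\<nu>. norm (f x - s i x)) < r / 4" by simp
  obtain N where N: "\<And>n. n \<ge> N \<Longrightarrow> \<bar>translation_defect \<nu> (s i) (t n)\<bar> < r / 2"
    using LIMSEQ_D[OF Q[of i], of "r/2"] \<open>0 < r\<close> by auto
  have "translation_defect \<nu> f (t n) < r" if "n \<ge> N" for n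
  proof -
    have "translation_defect \<nu> (\<lambda>x. s i x + (f x - s i x)) (t n) \<le>
        translation_defect \<nu> (s i) (t n) + translation_defect \<nu> (\<lambda>x. f x - s i x) (t n)"
      using f s by (intro translation_defect_add[OF h]) auto
    then show ?thesis
      using translation_defect_le[OF h, of "\<lambda>x. f x - s i x" "t n"] f s[of i] i N[OF that] by simp
  qed
  then show "\<exists>N. \<forall>n\<ge>N. norm (translation_defect \<nu> f (t n) - 0) < r"
    using translation_defect_nonneg[of \<nu> f] by auto
qed

text \<open>A point of an open set stays in it under small translations, so the measure of the
  points that leave tends to 0 by dominated convergence. By invariance, as much enters as
  leaves.\<close>

lemma translation_defect_open:
  fixes U :: "'x::{topological_ab_group_add,metric_space} set"
  assumes h: "haar_measure \<nu>" and U: "open U" and t: "t \<longlonglongrightarrow> 0"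
  shows "(\<lambda>n. translation_defect \<nu> (indicator U :: 'x \<Rightarrow> real) (t n)) \<longlonglongrightarrow> 0"
proof -
  interpret prob_space \<nu> by (rule haar_prob_space[OF h])
  define i :: "'x \<Rightarrow> real" where "i = indicator U"
  have mb: "i \<in> borel_measurable borel" using U by (simp add: i_def)
  have bound: "norm (i x) \<le> 1" "0 \<le> i x" "i x \<le> 1" for x by (auto simp: i_def indicator_def)
  have m [measurable]: "i \<in> borel_measurable \<nu>" "(\<lambda>x. i (x + a)) \<in> borel_measurable \<nu>" for a
    using mb measurable_compose[OF translate_measurable mb, of a] haar_measurable[OF h] by auto
  have bdd: "integrable \<nu> f" if "f \<in> borel_measurable \<nu>" "\<And>x. norm (f x) \<le> 1" for f :: "'x \<Rightarrow> real"
    using that by (intro integrable_const_bound[where B=1]) auto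
  have int: "integrable \<nu> i" "integrable \<nu> (\<lambda>x. i (x + a))" "integrable \<nu> (\<lambda>x. i x * (1 - i (x + a)))" for a
  proof -
    show "integrable \<nu> i" by (rule bdd[OF m(1) bound(1)])
    show "integrable \<nu> (\<lambda>x. i (x + a))" by (rule bdd[OF m(2) bound(1)])
    show "integrable \<nu> (\<lambda>x. i x * (1 - i (x + a)))"
      using m by (intro bdd) (auto simp: i_def indicator_def[abs_def])
  qed
  have "translation_defect \<nu> i a = 2 * (LINT x|\<nu>. i x * (1 - i (x + a)))" for a
  proof -
    \<comment> \<open>Pointwise, the absolute difference of two 0-1 values is twice the part that
      leaves plus a signed difference; the latter integrates to 0 by invariance.\<close>
    have "translation_defect \<nu> i a = (LINT x|\<nu>. 2 * (i x * (1 - i (x + a))) + (i (x + a) - i x))"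
      unfolding translation_defect_def
      by (intro Bochner_Integration.integral_cong) (auto simp: i_def indicator_def)
    also have "\<dots> = 2 * (LINT x|\<nu>. i x * (1 - i (x + a))) + ((LINT x|\<nu>. i (x + a)) - (LINT x|\<nu>. i x))"
      using int by simp
    finally show ?thesis by (simp add: haar_integral_translate[OF h mb])
  qed
  moreover have "(\<lambda>n. LINT x|\<nu>. i x * (1 - i (x + t n))) \<longlonglongrightarrow> (LINT x|\<nu>. 0)"
  proof (rule integral_dominated_convergence[where w="\<lambda>_. 1"])
    show "AE x in \<nu>. (\<lambda>n. i x * (1 - i (x + t n))) \<longlonglongrightarrow> 0"
    proof (rule AE_I2)
      fix x
      have "(\<lambda>n. x + t n) \<longlonglongrightarrow> x"
        using tendsto_add[OF tendsto_const t, of x] by simp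
      then have "\<forall>\<^sub>F n in sequentially. x \<in> U \<longrightarrow> x + t n \<in> U"
        using topological_tendstoD[OF _ U] by (cases "x \<in> U") auto
      then show "(\<lambda>n. i x * (1 - i (x + t n))) \<longlonglongrightarrow> 0"
        by (intro tendsto_eventually) (auto elim!: eventually_mono simp: i_def indicator_def)
    qed
    show "AE x in \<nu>. norm (i x * (1 - i (x + t n))) \<le> 1" for n
      by (rule AE_I2) (simp add: i_def indicator_def)
  qed auto
  ultimately show ?thesis
    using tendsto_mult_right_zero[of "\<lambda>n. LINT x|\<nu>. i x * (1 - i (x + t n))" sequentially 2]
    by (simp add: i_def)
qed

text \<open>A Dynkin argument from the intersection-stable generator of open sets: complements have
  the same defect, and disjoint unions are L1 limits of finite sums.\<close>

lemma translation_defect_indicator: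
  fixes A :: "'x::{topological_ab_group_add,metric_space} set"
  assumes h: "haar_measure \<nu>" and A: "A \<in> sets borel" and t: "t \<longlonglongrightarrow> 0"
  shows "(\<lambda>n. translation_defect \<nu> (indicator A :: 'x \<Rightarrow> real) (t n)) \<longlonglongrightarrow> 0"
proof -
  interpret prob_space \<nu> by (rule haar_prob_space[OF h])
  have int: "integrable \<nu> (indicator B :: 'x \<Rightarrow> real)" if "B \<in> sets borel" for B
    using that by (simp add: haar_sets[OF h] emeasure_eq_measure)
  have "Int_stable {S :: 'x set. open S}" by (auto simp: Int_stable_def)
  moreover have "{S :: 'x set. open S} \<subseteq> Pow UNIV" by simp
  moreover have "A \<in> sigma_sets UNIV {S. open S}" using A by (simp add: borel_def)
  ultimately show ?thesis
  proof (induction A rule: sigma_sets_induct_disjoint)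
    case (basic A)
    then show ?case using translation_defect_open[OF h _ t] by simp
  next
    case empty
    then show ?case by (simp add: translation_defect_def)
  next
    case (compl A)
    have "translation_defect \<nu> (indicator (UNIV - A) :: 'x \<Rightarrow> real) a =
        translation_defect \<nu> (indicator A :: 'x \<Rightarrow> real) a" for a
      unfolding translation_defect_def
      by (intro Bochner_Integration.integral_cong) (auto simp: indicator_def)
    then show ?case using compl by simp
  next
    case (union A)
    have Ab: "A i \<in> sets borel" for i using union.hyps(2) by (auto simp: borel_def)
    define s :: "nat \<Rightarrow> 'x \<Rightarrow> real" where "s n x = (\<Sum>i<n. indicator (A i) x)" for n x
    have s_int: "integrable \<nu> (s n)" for n
      unfolding s_def using int Ab by (intro Bochner_Integration.integrable_sum) auto
    have sums: "(\<lambda>i. indicator (A i) x :: real) sums indicator (\<Union>i. A i) x" for x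
      using union.hyps(1) by (intro indicator_sums) (auto simp: disjoint_family_on_def)
    then have slim: "(\<lambda>n. s n x) \<longlonglongrightarrow> indicator (\<Union>i. A i) x" for x
      by (simp add: sums_def s_def)
    have U: "integrable \<nu> (indicator (\<Union>i. A i) :: 'x \<Rightarrow> real)" using Ab by (intro int) auto
    show ?case
    proof (rule translation_defect_lim[OF h U s_int])
      have "(\<lambda>n. LINT x|\<nu>. norm (indicator (\<Union>i. A i) x - s n x)) \<longlonglongrightarrow> (LINT x|\<nu>. 0)"
      proof (rule integral_dominated_convergence[where w="\<lambda>_. 1"])
        show "AE x in \<nu>. (\<lambda>n. norm (indicator (\<Union>i. A i) x - s n x)) \<longlonglongrightarrow> 0"
        proof (rule AE_I2)
          fix x
          have "(\<lambda>n. indicator (\<Union>i. A i) x - s n x) \<longlonglongrightarrow> indicator (\<Union>i. A i) x - indicator (\<Union>i. A i) x"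
            by (intro tendsto_diff tendsto_const slim)
          then show "(\<lambda>n. norm (indicator (\<Union>i. A i) x - s n x)) \<longlonglongrightarrow> 0"
            by (intro tendsto_norm_zero) simp
        qed
        have "0 \<le> s n x" "s n x \<le> indicator (\<Union>i. A i) x" for n x
          using sums[of x] sum_le_suminf[of "\<lambda>i. indicator (A i) x :: real" "{..<n}"]
          by (auto simp: s_def sums_iff intro: sum_nonneg)
        then show "AE x in \<nu>. norm (norm (indicator (\<Union>i. A i) x - s n x)) \<le> 1" for n
          by (intro AE_I2) (simp add: abs_le_iff, smt (verit) indicator_le_1)
      qed (use U s_int in auto)
      then show "(\<lambda>n. LINT x|\<nu>. norm (indicator (\<Union>i. A i) x - s n x)) \<longlonglongrightarrow> 0" by simp
      show "(\<lambda>n. translation_defect \<nu> (s k) (t n)) \<longlonglongrightarrow> 0" for k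
      proof (induction k)
        case 0
        then show ?case by (simp add: s_def translation_defect_def)
      next
        case (Suc k)
        have "translation_defect \<nu> (s (Suc k)) a \<le>
            translation_defect \<nu> (s k) a + translation_defect \<nu> (indicator (A k) :: 'x \<Rightarrow> real) a" for a
          using translation_defect_add[OF h s_int int[OF Ab], of k k a] by (simp add: s_def[abs_def])
        then have "\<forall>\<^sub>F n in sequentially. norm (translation_defect \<nu> (s (Suc k)) (t n)) \<le>
            translation_defect \<nu> (s k) (t n) + translation_defect \<nu> (indicator (A k) :: 'x \<Rightarrow> real) (t n)"
          by (simp add: translation_defect_nonneg)
        then show ?case
          by (rule Lim_null_comparison) (use tendsto_add[OF Suc union.IH[of k]] in simp)
      qed
    qed
  qed
qed

text \<open>Induction along simple approximation: multiples of indicators, sums, then L1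
  limits.\<close>

lemma translation_defect_tendsto:
  fixes f :: "'x::{topological_ab_group_add,metric_space} \<Rightarrow> 'b::{banach,second_countable_topology}"
  assumes h: "haar_measure \<nu>" and f: "integrable \<nu> f" and t: "t \<longlonglongrightarrow> 0"
  shows "(\<lambda>n. translation_defect \<nu> f (t n)) \<longlonglongrightarrow> 0"
  using f
proof (induction f rule: integrable_induct)
  case (base A c)
  have "translation_defect \<nu> (\<lambda>x. indicator A x *\<^sub>R c) a =
      translation_defect \<nu> (indicator A :: 'x \<Rightarrow> real) a * norm c" for a
    unfolding translation_defect_def by (simp flip: scaleR_diff_left)
  then show ?case
    using translation_defect_indicator[OF h _ t, of A] base(1)
    by (simp add: haar_sets[OF h] tendsto_mult_left_zero)
next
  case (add f g)
  have "\<forall>\<^sub>F n in sequentially. norm (translation_defect \<nu> (\<lambda>x. f x + g x) (t n)) \<le>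
      translation_defect \<nu> f (t n) + translation_defect \<nu> g (t n)"
    using translation_defect_add[OF h add.hyps] by (simp add: translation_defect_nonneg)
  then show ?case
    by (rule Lim_null_comparison) (use tendsto_add[OF add.IH] in simp)
next
  case (lim f s)
  have "(\<lambda>i. LINT x|\<nu>. norm (f x - s i x)) \<longlonglongrightarrow> (LINT x|\<nu>. 0)"
  \<comment> \<open>The approximants satisfy \<open>norm (s i x) \<le> 2 * norm (f x)\<close>, so
    the difference is dominated with factor 3.\<close>
  proof (rule integral_dominated_convergence[where w="\<lambda>x. 3 * norm (f x)"])
    show "AE x in \<nu>. (\<lambda>i. norm (f x - s i x)) \<longlonglongrightarrow> 0"
    proof (rule AE_I2)
      fix x assume "x \<in> space \<nu>"
      then have "(\<lambda>i. f x - s i x) \<longlonglongrightarrow> f x - f x"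
        by (intro tendsto_diff tendsto_const lim.hyps(2))
      then show "(\<lambda>i. norm (f x - s i x)) \<longlonglongrightarrow> 0"
        by (intro tendsto_norm_zero) simp
    qed
    show "AE x in \<nu>. norm (norm (f x - s i x)) \<le> 3 * norm (f x)" for i
    proof (rule AE_I2)
      fix x assume "x \<in> space \<nu>"
      then show "norm (norm (f x - s i x)) \<le> 3 * norm (f x)"
        using lim.hyps(3)[of x i] norm_triangle_ineq4[of "f x" "s i x"] by simp
    qed
  qed (use lim.hyps in auto)
  then show ?case
    using translation_defect_lim[OF h lim.hyps(4) lim.hyps(1) _ lim.IH] by simp
qed

section \<open>The autocorrelation of a unimodular function\<close>

text \<open>A matrix coefficient of the regular representation on L2. It has a definite value at
  each \<open>t\<close>, although \<open>b\<close> is controlled only almost everywhere.\<close>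

definition translation_correlation ::
  "('x::{topological_ab_group_add,metric_space}) measure \<Rightarrow> ('x \<Rightarrow> complex) \<Rightarrow> 'x \<Rightarrow> complex" where
  "translation_correlation \<nu> b t = (LINT x|\<nu>. b (x + t) * cnj (b x))"

lemma borel_measurable_cnj [measurable]: "cnj \<in> borel_measurable borel"
  by (intro borel_measurable_continuous_onI continuous_intros)

lemma unimodular_translate:
  fixes b :: "'x::{topological_ab_group_add,metric_space} \<Rightarrow> complex"
  assumes h: "haar_measure \<nu>" and b: "b \<in> borel_measurable \<nu>" and b1: "\<And>x. cmod (b x) = 1"
  shows "integrable \<nu> (\<lambda>x. b (x + s))" and "integrable \<nu> (\<lambda>x. b (x + s) * cnj (b (x + t)))"
    and "(\<lambda>x. b (x + s) * cnj (b (x + t))) \<in> borel_measurable borel"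
proof -
  interpret prob_space \<nu> by (rule haar_prob_space[OF h])
  have bb: "b \<in> borel_measurable borel" using b unfolding haar_measurable[OF h] .
  have [measurable]: "(\<lambda>x. b (x + a)) \<in> borel_measurable borel" for a
    by (rule measurable_compose[OF translate_measurable bb])
  show m: "(\<lambda>x. b (x + s) * cnj (b (x + t))) \<in> borel_measurable borel"
    by measurable
  have "(\<lambda>x. b (x + s)) \<in> borel_measurable borel" by measurable
  then show "integrable \<nu> (\<lambda>x. b (x + s))"
    by (intro integrable_const_bound[where B=1]) (simp_all add: b1 haar_measurable[OF h])
  show "integrable \<nu> (\<lambda>x. b (x + s) * cnj (b (x + t)))"
    using m by (intro integrable_const_bound[where B=1]) (simp_all add: b1 norm_mult haar_measurable[OF h])
qed

lemma translation_correlation_0: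
  fixes b :: "'x::{topological_ab_group_add,metric_space} \<Rightarrow> complex"
  assumes h: "haar_measure \<nu>" and b1: "\<And>x. cmod (b x) = 1"
  shows "translation_correlation \<nu> b 0 = 1"
proof -
  interpret prob_space \<nu> by (rule haar_prob_space[OF h])
  have "b x * cnj (b x) = 1" for x using b1[of x] by (simp add: complex_norm_square[symmetric])
  then show ?thesis by (simp add: translation_correlation_def prob_space)
qed

text \<open>Since \<open>b\<close> has modulus 1, the difference of the values at \<open>s\<close>
  and \<open>t\<close> is at most the translation defect of \<open>b\<close> at
  \<open>s - t\<close>, which tends to 0 with \<open>s - t\<close>.\<close>

lemma translation_correlation_continuous:
  fixes b :: "'x::{topological_ab_group_add,metric_space} \<Rightarrow> complex"
  assumes h: "haar_measure \<nu>" and b: "b \<in> borel_measurable \<nu>" and b1: "\<And>x. cmod (b x) = 1"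
  shows "continuous_on UNIV (translation_correlation \<nu> b)"
proof -
  let ?\<rho> = "translation_correlation \<nu> b"
  note unim = unimodular_translate[OF h b b1]
  have bi: "integrable \<nu> b" using unim(1)[of 0] by simp
  have bb: "b \<in> borel_measurable borel" using b unfolding haar_measurable[OF h] .
  have diff: "norm (?\<rho> s - ?\<rho> t) \<le> translation_defect \<nu> b (s - t)" for s t
  proof -
    have "?\<rho> s - ?\<rho> t = (LINT x|\<nu>. (b (x + s) - b (x + t)) * cnj (b x))"
      unfolding translation_correlation_def left_diff_distrib
      using unim(2)[of s 0] unim(2)[of t 0] by simp
    also have "norm \<dots> \<le> (LINT x|\<nu>. norm ((b (x + s) - b (x + t)) * cnj (b x)))"
      by (rule integral_norm_bound)
    also have "\<dots> = (LINT x|\<nu>. norm (b (x + t + (s - t)) - b (x + t)))"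
      by (simp add: norm_mult b1 add.assoc)
    also have "\<dots> = translation_defect \<nu> b (s - t)"
      unfolding translation_defect_def
    proof (rule haar_integral_translate[OF h])
      have "(\<lambda>x. b (x + (s - t))) \<in> borel_measurable borel"
        by (rule measurable_compose[OF translate_measurable bb])
      then show "(\<lambda>x. norm (b (x + (s - t)) - b x)) \<in> borel_measurable borel"
        using bb by measurable
    qed
    finally show ?thesis .
  qed
  show ?thesis
    unfolding continuous_on_sequentially
  proof (intro ballI allI impI)
    fix u :: "nat \<Rightarrow> 'x" and t :: 'x
    assume "(\<forall>n. u n \<in> UNIV) \<and> u \<longlonglongrightarrow> t"
    then have "(\<lambda>n. u n - t) \<longlonglongrightarrow> 0"
      using tendsto_diff[OF _ tendsto_const, of u t sequentially t] by simp
    then have "(\<lambda>n. translation_defect \<nu> b (u n - t)) \<longlonglongrightarrow> 0"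
      by (rule translation_defect_tendsto[OF h bi])
    then have "(\<lambda>n. ?\<rho> (u n) - ?\<rho> t) \<longlonglongrightarrow> 0"
      by (rule Lim_null_comparison[rotated]) (simp add: diff)
    then show "(?\<rho> \<circ> u) \<longlonglongrightarrow> ?\<rho> t"
      unfolding comp_def by (rule LIM_zero_cancel)
  qed
qed

text \<open>Equality case of the triangle inequality: a unimodular function with integral 1 has real
  part 1 almost everywhere, hence equals 1 almost everywhere.\<close>

lemma translation_correlation_unimodular:
  fixes b :: "'x::{topological_ab_group_add,metric_space} \<Rightarrow> complex"
  assumes h: "haar_measure \<nu>" and b: "b \<in> borel_measurable \<nu>" and b1: "\<And>x. cmod (b x) = 1"
    and r: "cmod (translation_correlation \<nu> b t) = 1"
  shows "AE x in \<nu>. b (x + t) = translation_correlation \<nu> b t * b x"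
proof -
  interpret prob_space \<nu> by (rule haar_prob_space[OF h])
  let ?r = "translation_correlation \<nu> b t"
  \<comment> \<open>The factor \<open>cnj ?r\<close> rotates the integrand so that its integral
    becomes \<open>cnj ?r * ?r = 1\<close>.\<close>
  define w where "w x = cnj ?r * (b (x + t) * cnj (b x))" for x
  have int: "integrable \<nu> w"
    unfolding w_def using unimodular_translate(2)[OF h b b1, of t 0] by simp
  have rr: "cnj ?r * ?r = 1" using r by (simp add: complex_norm_square[symmetric] mult.commute)
  have w1: "cmod (w x) = 1" for x by (simp add: w_def norm_mult b1 r)
  have "(LINT x|\<nu>. w x) = 1"
    using rr by (simp add: w_def translation_correlation_def)
  then have "(LINT x|\<nu>. 1 - Re (w x)) = 0"
    using int by (simp add: prob_space)
  moreover have "integrable \<nu> (\<lambda>x. 1 - Re (w x))" using int by simp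
  moreover have "0 \<le> 1 - Re (w x)" for x using complex_Re_le_cmod[of "w x"] w1[of x] by simp
  ultimately have "AE x in \<nu>. 1 - Re (w x) = 0"
    using integral_nonneg_eq_0_iff_AE[of \<nu> "\<lambda>x. 1 - Re (w x)"] by simp
  then show ?thesis
  proof (eventually_elim)
    case (elim x)
    have "(Im (w x))\<^sup>2 = 0" using elim w1[of x] cmod_power2[of "w x"] by simp
    then have "w x = 1" using elim by (simp add: complex_eq_iff)
    then have "?r * w x * b x = ?r * b x" by simp
    moreover have "?r * w x * b x = (cnj ?r * ?r) * (b x * cnj (b x)) * b (x + t)"
      by (simp add: w_def)
    moreover have "b x * cnj (b x) = 1" using b1[of x] by (simp add: complex_norm_square[symmetric])
    ultimately show ?case using rr by simp
  qed
qed

text \<open>Translating \<open>b\<close> by \<open>t\<close> and then by \<open>s\<close> multiplies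
  it by \<open>?\<rho> s\<close> in the second move; integrating against \<open>cnj (b x)\<close>
  gives multiplicativity at every pair, free of null sets.\<close>

lemma translation_correlation_dual_char:
  fixes b :: "'x::{topological_ab_group_add,metric_space} \<Rightarrow> complex"
  assumes h: "haar_measure \<nu>" and b: "b \<in> borel_measurable \<nu>" and b1: "\<And>x. cmod (b x) = 1"
    and r: "\<And>t. cmod (translation_correlation \<nu> b t) = 1"
  shows "dual_char (translation_correlation \<nu> b)"
proof -
  let ?\<rho> = "translation_correlation \<nu> b"
  note unim = unimodular_translate[OF h b b1]
  have "?\<rho> (s + t) = ?\<rho> s * ?\<rho> t" for s t
  proof -
    have "AE x in \<nu>. b (x + t + s) = ?\<rho> s * b (x + t)"
      by (rule haar_AE_translate[OF h translation_correlation_unimodular[OF h b b1 r]])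
    then have "AE x in \<nu>. b (x + (s + t)) * cnj (b x) = ?\<rho> s * (b (x + t) * cnj (b x))"
      by eventually_elim (simp add: algebra_simps)
    then have "?\<rho> (s + t) = (LINT x|\<nu>. ?\<rho> s * (b (x + t) * cnj (b x)))"
      unfolding translation_correlation_def[of \<nu> b "s + t"]
      using unim(2)[of "s + t" 0] unim(2)[of t 0] by (intro integral_cong_AE) auto
    also have "\<dots> = ?\<rho> s * ?\<rho> t" by (simp add: translation_correlation_def)
    finally show ?thesis .
  qed
  then show ?thesis
    using translation_correlation_continuous[OF h b b1] r by (simp add: dual_char_def)
qed

section \<open>Autocorrelation of twisted eigenfunctions of the action\<close>

text \<open>Substitute \<open>\<sigma> g x\<close> for the integration variable and use the
  eigenrelation at \<open>x + t\<close> and at \<open>x\<close>. The factors \<open>\<kappa>\<close>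
  and \<open>\<xi> x\<close> meet their own conjugates and cancel; only \<open>\<xi> t\<close>
  survives.\<close>

lemma translation_correlation_equivariant:
  fixes \<sigma> :: "'g::group_add \<Rightarrow> 'x::{topological_ab_group_add,metric_space} \<Rightarrow> 'x"
  assumes c: "compact (UNIV :: 'x set)" and h: "haar_measure \<nu>" and act: "algebraic_action \<sigma>"
    and b: "b \<in> borel_measurable \<nu>" and b1: "\<And>x. cmod (b x) = 1"
    and \<xi>: "dual_char \<xi>" and \<kappa>: "cmod \<kappa> = 1"
    and eig: "AE x in \<nu>. b (\<sigma> g x) = \<kappa> * \<xi> x * b x"
  shows "translation_correlation \<nu> b (\<sigma> g t) = \<xi> t * translation_correlation \<nu> b t"
proof -
  note unim = unimodular_translate[OF h b b1]
  have bb: "b \<in> borel_measurable borel" using b unfolding haar_measurable[OF h] .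
  have bs: "(\<lambda>x. b (\<sigma> g x)) \<in> borel_measurable \<nu>"
    by (rule measurable_compose[OF action_measurable[OF h act] bb])
  then have bsb: "(\<lambda>x. b (\<sigma> g x)) \<in> borel_measurable borel" unfolding haar_measurable[OF h] .
  have bst: "(\<lambda>x. b (\<sigma> g (x + t))) \<in> borel_measurable \<nu>"
    using measurable_compose[OF translate_measurable bsb] unfolding haar_measurable[OF h] .
  have hom: "\<sigma> g (x + t) = \<sigma> g x + \<sigma> g t" for x using act by (simp add: algebraic_action_def)
  have "translation_correlation \<nu> b (\<sigma> g t) = (LINT x|\<nu>. b (\<sigma> g x + \<sigma> g t) * cnj (b (\<sigma> g x)))"
    unfolding translation_correlation_def
    using haar_integral_action[OF c h act, of "\<lambda>x. b (x + \<sigma> g t) * cnj (b x)" g] unim(3)[of "\<sigma> g t" 0] by simp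
  also have "\<dots> = (LINT x|\<nu>. \<xi> t * (b (x + t) * cnj (b x)))"
  proof (rule integral_cong_AE)
    show "AE x in \<nu>. b (\<sigma> g x + \<sigma> g t) * cnj (b (\<sigma> g x)) = \<xi> t * (b (x + t) * cnj (b x))"
      using eig haar_AE_translate[OF h eig, of t]
    proof eventually_elim
      case (elim x)
      have "b (\<sigma> g x + \<sigma> g t) * cnj (b (\<sigma> g x)) =
          (\<kappa> * \<xi> (x + t) * b (x + t)) * cnj (\<kappa> * \<xi> x * b x)"
        using elim by (simp add: hom)
      also have "\<dots> = (\<kappa> * cnj \<kappa>) * (\<xi> x * cnj (\<xi> x)) * (\<xi> t * (b (x + t) * cnj (b x)))"
        using \<xi> by (simp add: dual_char_def)
      finally show ?case
        using \<kappa> \<xi> by (simp add: complex_norm_square[symmetric] dual_char_def)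
    qed
    show "(\<lambda>x. b (\<sigma> g x + \<sigma> g t) * cnj (b (\<sigma> g x))) \<in> borel_measurable \<nu>"
      using borel_measurable_times[OF bst measurable_compose[OF bs borel_measurable_cnj]]
      by (simp add: hom)
    show "(\<lambda>x. \<xi> t * (b (x + t) * cnj (b x))) \<in> borel_measurable \<nu>"
      using unim(2)[of t 0] by simp
  qed
  also have "\<dots> = \<xi> t * translation_correlation \<nu> b t" by (simp add: translation_correlation_def)
  finally show ?thesis .
qed

text \<open>Common core of both injectivity proofs. There \<open>\<kappa>\<close> carries the values
  of circle homomorphisms, while \<open>\<xi>\<close> is trivial or the quotient of two dual
  cocycles.\<close>

lemma twisted_eigenfunction:
  fixes \<sigma> :: "'g::group_add \<Rightarrow> 'x::{topological_ab_group_add,metric_space} \<Rightarrow> 'x"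
  assumes c: "compact (UNIV :: 'x set)" and h: "haar_measure \<nu>" and act: "algebraic_action \<sigma>"
    and wm: "weakly_mixing \<sigma> \<nu>"
    and b: "b \<in> borel_measurable \<nu>" and b1: "\<And>x. cmod (b x) = 1"
    and \<xi>: "\<And>g. dual_char (\<xi> g)" and \<kappa>: "\<And>g. cmod (\<kappa> g) = 1"
    and eig: "\<And>g. AE x in \<nu>. b (\<sigma> (- g) x) = \<kappa> g * \<xi> g x * b x"
  shows "dual_char (translation_correlation \<nu> b)"
    and "\<And>g t. translation_correlation \<nu> b (\<sigma> (- g) t) = \<xi> g t * translation_correlation \<nu> b t"
    and "\<And>t. AE x in \<nu>. b (x + t) = translation_correlation \<nu> b t * b x"
proof -
  let ?\<rho> = "translation_correlation \<nu> b"
  show eqv: "?\<rho> (\<sigma> (- g) t) = \<xi> g t * ?\<rho> t" for g t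
    by (rule translation_correlation_equivariant[OF c h act b b1 \<xi> \<kappa> eig])
  have "cmod (?\<rho> (\<sigma> g t)) = cmod (?\<rho> t)" for g t
    using eqv[of "- g" t] \<xi>[of "- g"] by (simp add: norm_mult dual_char_def)
  then have "cmod (?\<rho> t) = cmod (?\<rho> 0)" for t
    by (rule invariant_continuous_const[OF c h wm
          continuous_on_norm[OF translation_correlation_continuous[OF h b b1]]])
  then have r: "cmod (?\<rho> t) = 1" for t
    using translation_correlation_0[OF h b1] by simp
  show "dual_char ?\<rho>" by (rule translation_correlation_dual_char[OF h b b1 r])
  show "AE x in \<nu>. b (x + t) = ?\<rho> t * b x" for t
    by (rule translation_correlation_unimodular[OF h b b1 r])
qed

text \<open>The exceptional null set depends on \<open>t\<close>. Fubini exchanges the quantifiers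
  and yields a single \<open>x\<close> with \<open>b (x + t) = b x\<close> for almost every
  \<open>t\<close>.\<close>

lemma AE_const_of_translation_invariant:
  fixes b :: "'x::{topological_ab_group_add,metric_space} \<Rightarrow> complex"
  assumes c: "compact (UNIV :: 'x set)" and h: "haar_measure \<nu>" and b: "b \<in> borel_measurable \<nu>"
    and inv: "\<And>t. AE x in \<nu>. b (x + t) = b x"
  shows "\<exists>k. AE x in \<nu>. b x = k"
proof -
  interpret prob_space \<nu> by (rule haar_prob_space[OF h])
  interpret P: pair_sigma_finite \<nu> \<nu> ..
  have bb: "b \<in> borel_measurable borel" using b unfolding haar_measurable[OF h] .
  have "(\<lambda>p. b (fst p + snd p)) \<in> borel_measurable (\<nu> \<Otimes>\<^sub>M \<nu>)"
    by (rule measurable_compose[OF plus_measurable_pair[OF c h h] bb])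
  moreover have "(\<lambda>p. b (fst p)) \<in> borel_measurable (\<nu> \<Otimes>\<^sub>M \<nu>)"
    using b by measurable
  ultimately have "{p \<in> space (\<nu> \<Otimes>\<^sub>M \<nu>). b (fst p + snd p) = b (fst p)} \<in> sets (\<nu> \<Otimes>\<^sub>M \<nu>)"
    by measurable
  then have "(AE x in \<nu>. AE t in \<nu>. b (x + t) = b x) \<longleftrightarrow> (AE t in \<nu>. AE x in \<nu>. b (x + t) = b x)"
    by (rule P.AE_commute)
  then have "AE x in \<nu>. AE t in \<nu>. b (x + t) = b x" using inv by simp
  then obtain x where "AE t in \<nu>. b (x + t) = b x"
    using eventually_happens'[OF ae_filter_bot] by blast
  \<comment> \<open>Shifting \<open>t\<close> by \<open>- x\<close> turns the relation into
    \<open>b t = b x\<close>, so the constant is the value of \<open>b\<close> at the chosen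
    point.\<close>
  then have "AE t in \<nu>. b (x + (t + - x)) = b x" by (rule haar_AE_translate[OF h])
  then show ?thesis by auto
qed

section \<open>Characters, and the passage from dual cocycles to measurable cocycles\<close>

lemma dual_char_nonzero: "dual_char \<xi> \<Longrightarrow> \<xi> x \<noteq> 0"
  by (metis dual_char_def norm_zero zero_neq_one)

lemma dual_char_mult: "dual_char \<xi> \<Longrightarrow> dual_char \<eta> \<Longrightarrow> dual_char (\<lambda>x. \<xi> x * \<eta> x)"
  by (auto simp: dual_char_def norm_mult intro!: continuous_on_mult)

lemma dual_char_inverse: "dual_char \<xi> \<Longrightarrow> dual_char (\<lambda>x. inverse (\<xi> x))"
  using dual_char_nonzero[of \<xi>]
  by (auto simp: dual_char_def norm_inverse intro!: continuous_on_inverse)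

lemma dual_char_measurable:
  assumes "haar_measure \<nu>" and "dual_char \<xi>"
  shows "\<xi> \<in> borel_measurable \<nu>"
  using assms(2) haar_measurable[OF assms(1)]
  by (metis borel_measurable_continuous_onI dual_char_def)

lemma dual_cocycle_meas_cocycle:
  assumes h: "haar_measure \<nu>" and c: "dual_cocycle \<sigma> c"
  shows "meas_cocycle \<sigma> \<nu> (tilde c)"
proof -
  have ch: "dual_char (c g)" for g using c by (simp add: dual_cocycle_def)
  have "c g2 (\<sigma> (- g1) x) * inverse (c (g1 + g2) x) * c g1 x = 1" for g1 g2 x
  proof -
    have "c (g1 + g2) x = c g1 x * c g2 (\<sigma> (- g1) x)"
      using c by (simp add: dual_cocycle_def dual_act_def)
    then show ?thesis using dual_char_nonzero[OF ch] by (simp add: field_simps)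
  qed
  then show ?thesis
    using ch dual_char_measurable[OF h ch]
    by (simp add: meas_cocycle_def tilde_def dual_char_def)
qed

lemma dual_cohomologous_meas_cohomologous:
  assumes h: "haar_measure \<nu>" and "dual_cohomologous \<sigma> c1 c2"
  shows "meas_cohomologous \<sigma> \<nu> (tilde c1) (tilde c2)"
proof -
  obtain b where "dual_char b" "\<And>g x. c1 g x * dual_act \<sigma> g b x * inverse (b x) = c2 g x"
    using assms(2) by (auto simp: dual_cohomologous_def)
  then show ?thesis
    using dual_char_measurable[OF h \<open>dual_char b\<close>]
    by (auto simp: meas_cohomologous_def tilde_def dual_act_def dual_char_def intro!: exI[of _ b])
qed

lemma dual_cocycle_mult:
  assumes "dual_cocycle \<sigma> c1" and "dual_cocycle \<sigma> c2"
  shows "dual_cocycle \<sigma> (\<lambda>g x. c1 g x * c2 g x)"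
  using assms by (auto simp: dual_cocycle_def dual_act_def intro: dual_char_mult)

section \<open>Injectivity of the two maps\<close>

text \<open>The transfer function is an eigenfunction with constant eigenvalues. Its autocorrelation
  is invariant, hence 1, so the function is almost everywhere constant and the two homomorphisms
  agree.\<close>

lemma Psi1_injective:
  fixes \<sigma> :: "'g::group_add \<Rightarrow> 'x::{topological_ab_group_add,metric_space} \<Rightarrow> 'x"
  assumes c: "compact (UNIV :: 'x set)" and h: "haar_measure \<nu>" and act: "algebraic_action \<sigma>"
    and wm: "weakly_mixing \<sigma> \<nu>"
    and \<phi>: "circle_hom \<phi>1" "circle_hom \<phi>2"
    and coh: "meas_cohomologous \<sigma> \<nu> (Psi1 \<phi>1) (Psi1 \<phi>2)"
  shows "\<phi>1 = \<phi>2"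
proof
  fix g
  interpret prob_space \<nu> by (rule haar_prob_space[OF h])
  obtain b where b: "b \<in> borel_measurable \<nu>" "\<And>x. cmod (b x) = 1"
    and co: "\<And>g. AE x in \<nu>. \<phi>1 g * b (\<sigma> (- g) x) * inverse (b x) = \<phi>2 g"
    using coh by (auto simp: meas_cohomologous_def Psi1_def)
  have n1: "cmod (\<phi>1 g) = 1" "cmod (\<phi>2 g) = 1" for g using \<phi> by (auto simp: circle_hom_def)
  have nz: "\<phi>1 g \<noteq> 0" "b x \<noteq> 0" for g x using n1(1)[of g] b(2)[of x] by auto
  let ?\<rho> = "translation_correlation \<nu> b"
  have one: "dual_char (\<lambda>x :: 'x. 1)" by (simp add: dual_char_def)
  have \<kappa>: "cmod (\<phi>2 g * inverse (\<phi>1 g)) = 1" for g by (simp add: n1 norm_mult norm_inverse)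
  have eig: "AE x in \<nu>. b (\<sigma> (- g) x) = \<phi>2 g * inverse (\<phi>1 g) * 1 * b x" for g
    using co[of g] by eventually_elim (use nz in \<open>auto simp: field_simps\<close>)
  note ev = twisted_eigenfunction[where \<xi> = "\<lambda>_ _. 1" and \<kappa> = "\<lambda>g. \<phi>2 g * inverse (\<phi>1 g)",
      OF c h act wm b one \<kappa> eig]
  have inv: "?\<rho> (\<sigma> g t) = ?\<rho> t" for g t using ev(2)[of "- g" t] by simp
  have "?\<rho> t = ?\<rho> 0" for t
    using inv by (rule invariant_continuous_const[OF c h wm translation_correlation_continuous[OF h b]])
  note \<rho>1 = trans[OF this translation_correlation_0[OF h b(2)]]
  have "AE x in \<nu>. b (x + t) = b x" for t
    using ev(3)[of t] by (simp add: \<rho>1)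
  then obtain k where k: "AE x in \<nu>. b x = k"
    using AE_const_of_translation_invariant[OF c h b(1)] by blast
  \<comment> \<open>Almost everywhere \<open>b\<close> equals \<open>k\<close> both at
    \<open>x\<close> and at \<open>\<sigma> (- g) x\<close>, so the coboundary factor is 1.\<close>
  have "AE x in \<nu>. \<phi>1 g = \<phi>2 g"
    using k haar_AE_action[OF c h act k, of "- g"] co[of g]
  proof eventually_elim
    case (elim x)
    have "k \<noteq> 0" using elim(1) nz(2)[of x] by simp
    then show ?case using elim by (simp add: mult.assoc)
  qed
  then show "\<phi>1 g = \<phi>2 g" by simp
qed

text \<open>The measurable transfer function \<open>b\<close> need not be a character, but its
  autocorrelation is one. It solves the same equation with the constants \<open>\<phi> g\<close>
  removed, at every point.\<close>

lemma Phi1_injective: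
  fixes \<sigma> :: "'g::group_add \<Rightarrow> 'x::{topological_ab_group_add,metric_space} \<Rightarrow> 'x"
  assumes c: "compact (UNIV :: 'x set)" and h: "haar_measure \<nu>" and act: "algebraic_action \<sigma>"
    and wm: "weakly_mixing \<sigma> \<nu>"
    and c12: "dual_cocycle \<sigma> c1" "dual_cocycle \<sigma> c2" and \<phi>: "circle_hom \<phi>"
    and coh: "meas_cohomologous \<sigma> \<nu> (tilde c1) (\<lambda>g x. tilde c2 g x * Psi1 \<phi> g x)"
  shows "dual_cohomologous \<sigma> c1 c2"
proof -
  obtain b where b: "b \<in> borel_measurable \<nu>" "\<And>x. cmod (b x) = 1"
    and co: "\<And>g. AE x in \<nu>. c1 g x * b (\<sigma> (- g) x) * inverse (b x) = c2 g x * \<phi> g"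
    using coh by (auto simp: meas_cohomologous_def Psi1_def tilde_def)
  have ch: "dual_char (c1 g)" "dual_char (c2 g)" for g using c12 by (auto simp: dual_cocycle_def)
  have nz: "c1 g x \<noteq> 0" "b x \<noteq> 0" for g x using dual_char_nonzero[OF ch(1)] b(2)[of x] by auto
  let ?\<rho> = "translation_correlation \<nu> b"
  \<comment> \<open>Solving the coboundary relation for \<open>b (\<sigma> (- g) x)\<close> leaves
    this quotient of characters as the twist and \<open>\<phi> g\<close> as the constant.\<close>
  let ?\<xi> = "\<lambda>g x. c2 g x * inverse (c1 g x)"
  have \<xi>: "dual_char (?\<xi> g)" for g by (intro dual_char_mult dual_char_inverse ch)
  have \<kappa>: "cmod (\<phi> g) = 1" for g using \<phi> by (simp add: circle_hom_def)
  have eig: "AE x in \<nu>. b (\<sigma> (- g) x) = \<phi> g * ?\<xi> g x * b x" for g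
    using co[of g] by eventually_elim (use nz in \<open>auto simp: field_simps\<close>)
  note ev = twisted_eigenfunction[where \<xi> = ?\<xi> and \<kappa> = \<phi>, OF c h act wm b \<xi> \<kappa> eig]
  have "c1 g x * dual_act \<sigma> g ?\<rho> x * inverse (?\<rho> x) = c2 g x" for g x
    using ev(2)[of g x] dual_char_nonzero[OF ev(1)] nz by (simp add: dual_act_def)
  then show ?thesis using ev(1) by (auto simp: dual_cohomologous_def)
qed

theorem theorem1p1:
  fixes \<sigma> :: "'g::group_add \<Rightarrow> 'x::{topological_ab_group_add,metric_space} \<Rightarrow> 'x"
    and \<nu> :: "'x measure"
  assumes "countable (UNIV :: 'g set)" and "infinite (UNIV :: 'g set)"
    and "compact (UNIV :: 'x set)"
    and "haar_measure \<nu>"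
    and "algebraic_action \<sigma>"
    and "weakly_mixing \<sigma> \<nu>"
  shows
    \<comment> \<open>Psi_1 is injective\<close>
    "(\<forall>\<phi>1 \<phi>2. circle_hom \<phi>1 \<and> circle_hom \<phi>2 \<and>
        meas_cohomologous \<sigma> \<nu> (Psi1 \<phi>1) (Psi1 \<phi>2) \<longrightarrow> \<phi>1 = \<phi>2)
     \<comment> \<open>Phi_1 well defined: tilde c is a measurable cocycle ...\<close>
     \<and> (\<forall>c. dual_cocycle \<sigma> c \<longrightarrow> meas_cocycle \<sigma> \<nu> (tilde c))
     \<comment> \<open>... and its class modulo Psi_1(H^1(G,T)) depends only on the class of c\<close>
     \<and> (\<forall>c1 c2. dual_cocycle \<sigma> c1 \<and> dual_cocycle \<sigma> c2 \<and> dual_cohomologous \<sigma> c1 c2 \<longrightarrow>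
          (\<exists>\<phi>. circle_hom \<phi> \<and>
             meas_cohomologous \<sigma> \<nu> (tilde c1) (\<lambda>g x. tilde c2 g x * Psi1 \<phi> g x)))
     \<comment> \<open>Phi_1 is a homomorphism\<close>
     \<and> (\<forall>c1 c2. dual_cocycle \<sigma> c1 \<and> dual_cocycle \<sigma> c2 \<longrightarrow>
          dual_cocycle \<sigma> (\<lambda>g x. c1 g x * c2 g x) \<and>
          tilde (\<lambda>g x. c1 g x * c2 g x) = (\<lambda>g x. tilde c1 g x * tilde c2 g x))
     \<comment> \<open>Phi_1 is injective\<close>
     \<and> (\<forall>c1 c2. dual_cocycle \<sigma> c1 \<and> dual_cocycle \<sigma> c2 \<and>
          (\<exists>\<phi>. circle_hom \<phi> \<and>
             meas_cohomologous \<sigma> \<nu> (tilde c1) (\<lambda>g x. tilde c2 g x * Psi1 \<phi> g x))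
          \<longrightarrow> dual_cohomologous \<sigma> c1 c2)"
proof (intro conjI allI impI; (elim conjE exE)?)
  note c = assms(3) and h = assms(4) and act = assms(5) and wm = assms(6)
  show "\<phi>1 = \<phi>2" if "circle_hom \<phi>1" "circle_hom \<phi>2" "meas_cohomologous \<sigma> \<nu> (Psi1 \<phi>1) (Psi1 \<phi>2)"
    for \<phi>1 \<phi>2
    using Psi1_injective[OF c h act wm] that .
  show "meas_cocycle \<sigma> \<nu> (tilde c)" if "dual_cocycle \<sigma> c" for c
    by (rule dual_cocycle_meas_cocycle[OF h that])
  show "\<exists>\<phi>. circle_hom \<phi> \<and> meas_cohomologous \<sigma> \<nu> (tilde c1) (\<lambda>g x. tilde c2 g x * Psi1 \<phi> g x)"
    if "dual_cohomologous \<sigma> c1 c2" for c1 c2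
    using dual_cohomologous_meas_cohomologous[OF h that]
    \<comment> \<open>The trivial homomorphism suffices: cohomologous dual cocycles have
      cohomologous images without any correction from \<open>Psi1\<close>.\<close>
    by (intro exI[of _ "\<lambda>_. 1"]) (simp add: circle_hom_def Psi1_def)
  show "dual_cocycle \<sigma> (\<lambda>g x. c1 g x * c2 g x)" if "dual_cocycle \<sigma> c1" "dual_cocycle \<sigma> c2" for c1 c2
    by (rule dual_cocycle_mult[OF that])
  show "tilde (\<lambda>g x. c1 g x * c2 g x) = (\<lambda>g x. tilde c1 g x * tilde c2 g x)"
    for c1 c2 :: "'g \<Rightarrow> 'x \<Rightarrow> complex"
    by (simp add: tilde_def)
  show "dual_cohomologous \<sigma> c1 c2"
    if "dual_cocycle \<sigma> c1" "dual_cocycle \<sigma> c2" "circle_hom \<phi>"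
      "meas_cohomologous \<sigma> \<nu> (tilde c1) (\<lambda>g x. tilde c2 g x * Psi1 \<phi> g x)" for c1 c2 \<phi>
    using Phi1_injective[OF c h act wm] that .
qed

end
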